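(* Let $\tau=\frac{1+\sqrt5}{2}$ and let $\mathcal{A}_D=\{H_1,\dots,H_6\}$ be the dodecahedral arrangement in $\mathbb{R}^3$, i.e. the arrangement of the $6$ planes through the origin with normal vectors $$\alpha_1=(1,0,\tau),\ \alpha_2=(1,0,-\tau),\ \alpha_3=(0,\tau,1),\ \alpha_4=(0,-\tau,1),\ \alpha_5=(\tau,1,0),\ \alpha_6=(-\tau,1,0).$$ Then the discriminantal arrangement $\mathcal{B}(6,3,\mathcal{A}_D)$ has $10$ non-very generic intersections.
   Context: For the generic arrangement $H_i=\ker\alpha_i$, $i=1,\dots,6$, in $\mathbb{R}^3$ (any three of the $\alpha_i$ are linearly independent), the translates $\{H_1^{x_1},\dots,H_6^{x_6}\}$, with $H_i^{x_i}$ parallel to $H_i$ (up to rescaling of $x_i$, $H_i^{x_i}=\{v:\alpha_i\cdot v=x_i\}$), are parametrized by $x\in\mathbb{R}^6$. For $L\subset\{1,\dots,6\}$ with $|L|=4$, $D_L\subset\mathbb{R}^6$ is the hyperplane of translates whose four planes indexed by $L$ have a common point; the discriminantal arrangement $\mathcal{B}(6,3,\mathcal{A})$ is the arrangement of all $D_L$. The non-very generic intersections of $\mathcal{B}(6,3,\mathcal{A})$ are the intersections $\bigcap_{L\in\mathbb{T}}D_L$, where $\mathbb{T}$ is a $3$-set of the form $\{\{p_1,p_2,p_3,p_4\},\{p_3,p_4,p_5,p_6\},\{p_1,p_2,p_5,p_6\}\}$ with $\{p_1,\dots,p_6\}=\{1,\dots,6\}$, whose codimension is strictly less than $3$ (i.e.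 the three hyperplanes $D_L$, $L\in\mathbb{T}$, are linearly dependent). *)

theory Defs
  imports "HOL-Analysis.Analysis"
begin

(* A central arrangement in R^'k indexed by 'n is given by its normal vectors alpha i;
   the planes H_i are the case c = 0. *)

definition translate :: "('n \<Rightarrow> real^'k) \<Rightarrow> 'n \<Rightarrow> real \<Rightarrow> (real^'k) set" where
  "translate \<alpha> i c = {v. \<alpha> i \<bullet> v = c}"

definition D :: "('n \<Rightarrow> real^'k) \<Rightarrow> 'n set \<Rightarrow> (real^'n) set" where
  "D \<alpha> L = {x. (\<Inter>i\<in>L. translate \<alpha> i (x $ i)) \<noteq> {}}"

definition discriminantal :: "('n::finite \<Rightarrow> real^'k) \<Rightarrow> (real^'n) set set" where
  "discriminantal \<alpha> = {D \<alpha> L | L. card L = CARD('k) + 1}"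

definition codim :: "(real^'n) set \<Rightarrow> nat" where
  "codim X = DIM(real^'n) - dim X"

(* The index set {1,...,6} is the type 6, in which the numeral 6 denotes the same element as 0. *)

definition good_triples :: "6 set set set" where
  "good_triples =
     {{{p1,p2,p3,p4}, {p3,p4,p5,p6}, {p1,p2,p5,p6}} | p1 p2 p3 p4 p5 p6.
        {p1,p2,p3,p4,p5,p6} = UNIV}"

(* A set of subspaces, so an intersection arising from several triples would count once. *)

definition non_very_generic_intersections :: "(6 \<Rightarrow> real^3) \<Rightarrow> (real^6) set set" where
  "non_very_generic_intersections \<alpha> =
     {\<Inter>L\<in>\<T>. D \<alpha> L | \<T>. \<T> \<in> good_triples \<and> codim (\<Inter>L\<in>\<T>. D \<alpha> L) < 3}"

definition golden :: real where
  "golden = (1 + sqrt 5) / 2"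

definition dodecahedral :: "6 \<Rightarrow> real^3" where
  "dodecahedral i =
     (if i = 1 then vector [1, 0, golden]
      else if i = 2 then vector [1, 0, - golden]
      else if i = 3 then vector [0, golden, 1]
      else if i = 4 then vector [0, - golden, 1]
      else if i = 5 then vector [golden, 1, 0]
      else vector [- golden, 1, 0])"

lemma good_triples_discriminantal:
  fixes \<alpha> :: "6 \<Rightarrow> real^3"
  assumes "\<T> \<in> good_triples"
  shows "card \<T> = 3" and "D \<alpha> ` \<T> \<subseteq> discriminantal \<alpha>"
proof -
  obtain p1 p2 p3 p4 p5 p6 where
    T: "\<T> = {{p1,p2,p3,p4}, {p3,p4,p5,p6}, {p1,p2,p5,p6}}" and
    U: "{p1,p2,p3,p4,p5,p6} = (UNIV :: 6 set)"
    using assms unfolding good_triples_def by blast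
  have "card (set [p1,p2,p3,p4,p5,p6]) = 6"
    using U by simp
  then have d: "distinct [p1,p2,p3,p4,p5,p6]"
    by (intro card_distinct) simp
  have ne: "{p1,p2,p3,p4} \<noteq> {p3,p4,p5,p6}" "{p1,p2,p3,p4} \<noteq> {p1,p2,p5,p6}"
    "{p3,p4,p5,p6} \<noteq> {p1,p2,p5,p6}"
    using d by auto
  show "card \<T> = 3"
    unfolding T using ne by simp
  have "card L = CARD(3) + 1" if "L \<in> \<T>" for L
    using that d unfolding T by auto
  then show "D \<alpha> ` \<T> \<subseteq> discriminantal \<alpha>"
    unfolding discriminantal_def by blast
qed

end

theory Submission
  imports Defs
begin

text \<open>
  Write \<open>[ijk]\<close> for the determinant of \<open>\<alpha> i, \<alpha> j, \<alpha> k\<close>. The hyperplane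
  \<open>D {a,b,c,d}\<close> is the orthogonal complement of the coefficient vector of the linear relation
  (Cramer's rule) between the four normals. For a pairing \<open>ab|cd|ef\<close> of the index set, the
  coordinates \<open>a, c, e\<close> of the three relation vectors form a \<open>3 \<times> 3\<close> matrix with zero diagonal, and
  its determinant \<open>[def][fab][bcd] + [cdf][efb][abd]\<close> vanishes exactly if the three vectors are
  dependent, because a relation supported on \<open>b, d, f\<close> is trivial in a generic arrangement.
  A degenerate intersection lies in no fourth hyperplane \<open>D L\<close>, so it determines its pairing, and
  it remains to evaluate the determinant at the 15 pairings of six indices.
\<close>

section \<open>Linear relations between four normals\<close>

definition bracket :: "('n \<Rightarrow> real^3) \<Rightarrow> 'n \<Rightarrow> 'n \<Rightarrow> 'n \<Rightarrow> real" where
  "bracket \<alpha> i j k = \<alpha> i \<bullet> cross3 (\<alpha> j) (\<alpha> k)"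

definition generic :: "('n \<Rightarrow> real^3) \<Rightarrow> bool" where
  "generic \<alpha> \<longleftrightarrow> (\<forall>i j k. distinct [i, j, k] \<longrightarrow> bracket \<alpha> i j k \<noteq> 0)"

text \<open>The signed maximal minors of the \<open>3 x 4\<close> matrix of normals, each placed at
  the index it omits; permuting the four indices changes at most the sign.\<close>

definition circuit :: "('n::finite \<Rightarrow> real^3) \<Rightarrow> 'n \<Rightarrow> 'n \<Rightarrow> 'n \<Rightarrow> 'n \<Rightarrow> real^'n" where
  "circuit \<alpha> a b c d =
     axis a (bracket \<alpha> b c d) - axis b (bracket \<alpha> a c d)
     + axis c (bracket \<alpha> a b d) - axis d (bracket \<alpha> a b c)"

lemma genericD: "generic \<alpha> \<Longrightarrow> distinct [i, j, k] \<Longrightarrow> bracket \<alpha> i j k \<noteq> 0"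
  by (simp add: generic_def)

lemma bracket_expand:
  "bracket \<alpha> i j k =
     \<alpha> i $ 1 * (\<alpha> j $ 2 * \<alpha> k $ 3 - \<alpha> j $ 3 * \<alpha> k $ 2)
     + \<alpha> i $ 2 * (\<alpha> j $ 3 * \<alpha> k $ 1 - \<alpha> j $ 1 * \<alpha> k $ 3)
     + \<alpha> i $ 3 * (\<alpha> j $ 1 * \<alpha> k $ 2 - \<alpha> j $ 2 * \<alpha> k $ 1)"
  by (simp add: bracket_def cross3_def inner_vec_def sum_3 vector_3)

lemma inner_circuit:
  "circuit \<alpha> a b c d \<bullet> x =
     bracket \<alpha> b c d * x $ a - bracket \<alpha> a c d * x $ b
     + bracket \<alpha> a b d * x $ c - bracket \<alpha> a b c * x $ d"
  by (simp add: circuit_def inner_diff_left inner_add_left inner_axis' mult.commute)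

text \<open>Cramer's relation among four normals, paired with an arbitrary vector
  \<open>v\<close>.\<close>

lemma inner_circuit_concurrent: "circuit \<alpha> a b c d \<bullet> (\<chi> i. \<alpha> i \<bullet> v) = 0"
  unfolding inner_circuit bracket_expand
  by (simp add: inner_vec_def sum_3 algebra_simps)

lemma D_eq_orthogonal_circuit:
  fixes \<alpha> :: "'n::finite \<Rightarrow> real^3"
  assumes nz: "bracket \<alpha> a b c \<noteq> 0"
  shows "D \<alpha> {a, b, c, d} = {x. circuit \<alpha> a b c d \<bullet> x = 0}"
proof (intro equalityI subsetI CollectI)
  fix x assume "x \<in> D \<alpha> {a, b, c, d}"
  then obtain v where v: "\<alpha> a \<bullet> v = x $ a" "\<alpha> b \<bullet> v = x $ b" "\<alpha> c \<bullet> v = x $ c" "\<alpha> d \<bullet> v = x $ d"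
    by (auto simp: D_def translate_def)
  have "circuit \<alpha> a b c d \<bullet> x = circuit \<alpha> a b c d \<bullet> (\<chi> i. \<alpha> i \<bullet> v)"
    by (simp add: inner_circuit v)
  then show "circuit \<alpha> a b c d \<bullet> x = 0"
    by (simp add: inner_circuit_concurrent)
next
  fix x assume "x \<in> {x. circuit \<alpha> a b c d \<bullet> x = 0}"
  then have x: "bracket \<alpha> b c d * x $ a - bracket \<alpha> a c d * x $ b + bracket \<alpha> a b d * x $ c
      = bracket \<alpha> a b c * x $ d"
    by (simp add: inner_circuit)
  \<comment> \<open>Cramer numerator for the common point of the planes \<open>a\<close>,
    \<open>b\<close>, \<open>c\<close>: after division by \<open>bracket \<alpha> a b c\<close> it
    lies on these three, and the circuit equation puts it on the fourth.\<close>
  define w where "w = (x $ a) *\<^sub>R cross3 (\<alpha> b) (\<alpha> c) + (x $ b) *\<^sub>R cross3 (\<alpha> c) (\<alpha> a)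
    + (x $ c) *\<^sub>R cross3 (\<alpha> a) (\<alpha> b)"
  have w: "\<alpha> i \<bullet> w = x $ a * bracket \<alpha> i b c + x $ b * bracket \<alpha> i c a + x $ c * bracket \<alpha> i a b" for i
    by (simp add: w_def bracket_def inner_add_right)
  have "\<alpha> a \<bullet> w = bracket \<alpha> a b c * x $ a" "\<alpha> b \<bullet> w = bracket \<alpha> a b c * x $ b"
    "\<alpha> c \<bullet> w = bracket \<alpha> a b c * x $ c"
    unfolding w bracket_expand by (simp_all add: algebra_simps)
  moreover have "\<alpha> d \<bullet> w = bracket \<alpha> a b c * x $ d"
    unfolding w x[symmetric] unfolding bracket_expand by (simp add: algebra_simps)
  ultimately have "w /\<^sub>R bracket \<alpha> a b c \<in> (\<Inter>i\<in>{a, b, c, d}. translate \<alpha> i (x $ i))"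
    using nz by (auto simp: translate_def)
  then show "x \<in> D \<alpha> {a, b, c, d}"
    unfolding D_def by blast
qed

lemma circuit_nth_support:
  assumes "distinct [a, b, c, d]"
  shows "circuit \<alpha> a b c d $ i =
    (if i = a then bracket \<alpha> b c d else if i = b then - bracket \<alpha> a c d
     else if i = c then bracket \<alpha> a b d else if i = d then - bracket \<alpha> a b c else 0)"
  using assms by (auto simp: circuit_def axis_def)

lemma circuit_nth_nonzero_iff:
  assumes "generic \<alpha>" "distinct [a, b, c, d]"
  shows "circuit \<alpha> a b c d $ i \<noteq> 0 \<longleftrightarrow> i \<in> {a, b, c, d}"
  using assms by (auto simp: circuit_nth_support genericD)

section \<open>Codimension of an intersection of three hyperplanes\<close>

lemma codim_orthogonal:
  fixes C :: "(real^'n) set"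
  shows "codim {x. \<forall>c\<in>C. c \<bullet> x = 0} = dim C"
proof -
  have "{x. \<forall>c\<in>C. c \<bullet> x = 0} = {y \<in> UNIV. \<forall>x\<in>span C. orthogonal x y}"
    by (auto simp: orthogonal_def span_base inner_commute
        intro: orthogonal_to_span[unfolded orthogonal_def])
  then have "dim {x. \<forall>c\<in>C. c \<bullet> x = 0} + dim (span C) = dim (UNIV :: (real^'n) set)"
    using dim_subspace_orthogonal_to_vectors[of "span C" UNIV] by simp
  then show ?thesis
    by (simp add: codim_def)
qed

text \<open>Writing \<open>[ijk]\<close> for brackets, the circuits on \<open>c d e f\<close>,
  \<open>e f a b\<close>, \<open>a b c d\<close> have the rows \<open>(0, [def], [cdf])\<close>,
  \<open>([efb], 0, [fab])\<close>, \<open>([bcd], [abd], 0)\<close> in the columns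
  \<open>a\<close>, \<open>c\<close>, \<open>e\<close>.\<close>

definition degeneracy :: "('n \<Rightarrow> real^3) \<Rightarrow> 'n \<Rightarrow> 'n \<Rightarrow> 'n \<Rightarrow> 'n \<Rightarrow> 'n \<Rightarrow> 'n \<Rightarrow> real" where
  "degeneracy \<alpha> a b c d e f =
     bracket \<alpha> d e f * bracket \<alpha> f a b * bracket \<alpha> b c d
     + bracket \<alpha> c d f * bracket \<alpha> e f b * bracket \<alpha> a b d"

definition triple :: "'n \<Rightarrow> 'n \<Rightarrow> 'n \<Rightarrow> 'n \<Rightarrow> 'n \<Rightarrow> 'n \<Rightarrow> 'n set set" where
  "triple a b c d e f = {{a, b, c, d}, {c, d, e, f}, {a, b, e, f}}"

text \<open>Each member is the union of two pairs, hence the complement of the third pair.\<close>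

lemma triple_eq_Compl:
  assumes "distinct [a, b, c, d, e, f]" "UNIV = {a, b, c, d, e, f}"
  shows "triple a b c d e f = uminus ` {{a, b}, {c, d}, {e, f}}"
proof -
  have "- {a, b} = {c, d, e, f}" "- {c, d} = {a, b, e, f}" "- {e, f} = {a, b, c, d}"
    unfolding Compl_eq_Diff_UNIV assms(2) using assms(1) by auto
  then show ?thesis by (auto simp: triple_def)
qed

locale pairing =
  fixes \<alpha> :: "'n::finite \<Rightarrow> real^3" and a b c d e f :: 'n
  assumes gen: "generic \<alpha>" and dist: "distinct [a, b, c, d, e, f]"
begin

abbreviation "u \<equiv> circuit \<alpha> c d e f"
abbreviation "v \<equiv> circuit \<alpha> e f a b"
abbreviation "w \<equiv> circuit \<alpha> a b c d"

text \<open>These are \<open>u $ c\<close> and \<open>v $ a\<close>, the pivots of the eliminations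
  below.\<close>

lemma bracket_nonzero: "bracket \<alpha> d e f \<noteq> 0" "bracket \<alpha> e f b \<noteq> 0"
  using gen dist by (auto simp: genericD)

lemma INT_triple: "(\<Inter>L\<in>triple a b c d e f. D \<alpha> L) = {x. \<forall>c\<in>{u, v, w}. c \<bullet> x = 0}"
proof -
  have "{a, b, e, f} = {e, f, a, b}" by auto
  moreover have "D \<alpha> {a, b, c, d} = {x. w \<bullet> x = 0}" "D \<alpha> {c, d, e, f} = {x. u \<bullet> x = 0}"
    "D \<alpha> {e, f, a, b} = {x. v \<bullet> x = 0}"
    using gen dist by (auto intro!: D_eq_orthogonal_circuit simp: genericD)
  ultimately show ?thesis unfolding triple_def by auto
qed

lemma codim_INT: "codim (\<Inter>L\<in>triple a b c d e f. D \<alpha> L) = dim {u, v, w}"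
  unfolding INT_triple by (rule codim_orthogonal)

text \<open>By \<open>orth\<close>, the combination of the normals with coefficients
  \<open>z\<close> is zero; the normals at \<open>b\<close>, \<open>d\<close>, \<open>f\<close> are
  linearly independent.\<close>

lemma relation_supported_on_bdf:
  assumes orth: "\<And>y. z \<bullet> (\<chi> i. \<alpha> i \<bullet> y) = 0"
    and supp: "\<And>i. i \<notin> {b, d, f} \<Longrightarrow> z $ i = 0"
  shows "z = 0"
proof -
  \<comment> \<open>Testing the relation on \<open>cross3 (\<alpha> j) (\<alpha> k)\<close> kills
    the terms at \<open>j\<close> and \<open>k\<close> and isolates the one at
    \<open>i\<close>.\<close>
  have *: "z $ i * bracket \<alpha> i j k = 0" if "{i, j, k} = {b, d, f}" for i j k
  proof -
    have "z $ l * bracket \<alpha> l j k = 0" if "l \<noteq> i" for l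
    proof (cases "l \<in> {b, d, f}")
      case True
      then have "l = j \<or> l = k" using \<open>{i, j, k} = {b, d, f}\<close> that by auto
      then show ?thesis by (auto simp: bracket_expand algebra_simps)
    qed (simp add: supp)
    then have "(\<Sum>l\<in>UNIV. z $ l * bracket \<alpha> l j k) = z $ i * bracket \<alpha> i j k"
      by (subst sum.remove[of _ i]) (simp_all add: sum.neutral del: mult_eq_0_iff)
    moreover have "(\<Sum>l\<in>UNIV. z $ l * bracket \<alpha> l j k) = 0"
      using orth[of "cross3 (\<alpha> j) (\<alpha> k)"] by (simp add: inner_vec_def bracket_def)
    ultimately show ?thesis by simp
  qed
  have "bracket \<alpha> b d f \<noteq> 0" "bracket \<alpha> d f b \<noteq> 0" "bracket \<alpha> f b d \<noteq> 0"
    using gen dist by (auto simp: genericD)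
  then have "z $ b = 0" "z $ d = 0" "z $ f = 0"
    using *[of b d f] *[of d f b] *[of f b d] by auto
  then show ?thesis
    using supp by (metis empty_iff insert_iff vec_eq_iff zero_index)
qed

text \<open>The coefficients are chosen to balance coordinates \<open>a\<close> and
  \<open>c\<close>. Coordinate \<open>e\<close> then differs by exactly the degeneracy, and a
  remainder supported on \<open>b\<close>, \<open>d\<close>, \<open>f\<close> must vanish.\<close>

lemma circuit_dependence:
  assumes "degeneracy \<alpha> a b c d e f = 0"
  shows "(bracket \<alpha> e f b * bracket \<alpha> a b d) *\<^sub>R u + (bracket \<alpha> d e f * bracket \<alpha> b c d) *\<^sub>R v
    = (bracket \<alpha> d e f * bracket \<alpha> e f b) *\<^sub>R w"
    (is "?l *\<^sub>R u + ?m *\<^sub>R v = ?n *\<^sub>R w")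
proof -
  have "?l *\<^sub>R u + ?m *\<^sub>R v - ?n *\<^sub>R w = 0"
  proof (rule relation_supported_on_bdf)
    show "(?l *\<^sub>R u + ?m *\<^sub>R v - ?n *\<^sub>R w) \<bullet> (\<chi> i. \<alpha> i \<bullet> y) = 0" for y
      by (simp add: inner_add_left inner_diff_left inner_circuit_concurrent)
  next
    fix i assume "i \<notin> {b, d, f}"
    then show "(?l *\<^sub>R u + ?m *\<^sub>R v - ?n *\<^sub>R w) $ i = 0"
      using dist assms by (auto simp: circuit_nth_support degeneracy_def algebra_simps)
  qed
  then show ?thesis by simp
qed

lemma codim_less_3_iff:
  "codim (\<Inter>L\<in>triple a b c d e f. D \<alpha> L) < 3 \<longleftrightarrow> degeneracy \<alpha> a b c d e f = 0"
proof
  assume deg: "degeneracy \<alpha> a b c d e f = 0"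
  let ?n = "bracket \<alpha> d e f * bracket \<alpha> e f b"
  have "?n \<noteq> 0" using bracket_nonzero by simp
  then have "w = (1 / ?n) *\<^sub>R (?n *\<^sub>R w)" by simp
  also have "\<dots> \<in> span {u, v}"
    unfolding circuit_dependence[OF deg, symmetric]
    by (intro span_scale span_add span_base) auto
  finally have "dim (insert w {u, v}) = dim {u, v}" by (simp add: dim_insert)
  moreover have "dim {u, v} \<le> 2"
    by (rule order_trans[OF dim_le_card'[of "{u, v}"]]) (auto simp: card_insert_if)
  ultimately show "codim (\<Inter>L\<in>triple a b c d e f. D \<alpha> L) < 3"
    unfolding codim_INT by (simp add: insert_commute)
next
  assume cod: "codim (\<Inter>L\<in>triple a b c d e f. D \<alpha> L) < 3"
  show "degeneracy \<alpha> a b c d e f = 0"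
  proof (rule ccontr)
    assume nz: "degeneracy \<alpha> a b c d e f \<noteq> 0"
    have nth: "u $ a = 0" "u $ c \<noteq> 0" "v $ a \<noteq> 0" "v $ c = 0" "w $ a \<noteq> 0"
      using gen dist by (auto simp: circuit_nth_support genericD)
    \<comment> \<open>Distinctness is what makes the sum over the set \<open>{u, v, w}\<close> have
      three separate terms and its cardinality equal 3.\<close>
    then have ne: "u \<noteq> v" "u \<noteq> w" "v \<noteq> w"
      using gen dist circuit_nth_nonzero_iff[of \<alpha> a b c d c] by auto
    have "independent {u, v, w}"
    proof (rule independent_if_scalars_zero)
      fix g x assume s: "(\<Sum>x\<in>{u, v, w}. g x *\<^sub>R x) = 0" and x: "x \<in> {u, v, w}"
      have s: "g u *\<^sub>R u + g v *\<^sub>R v + g w *\<^sub>R w = 0"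
        using s ne by (simp add: add.assoc)
      have "g u * u $ i + g v * v $ i + g w * w $ i = 0" for i
        using arg_cong[OF s, of "\<lambda>x. x $ i"] by simp
      from this[of a] this[of c] this[of e]
      have ga: "g v * bracket \<alpha> e f b = - g w * bracket \<alpha> b c d"
        and gc: "g u * bracket \<alpha> d e f = - g w * bracket \<alpha> a b d"
        and ge: "g u * bracket \<alpha> c d f + g v * bracket \<alpha> f a b = 0"
        using dist by (auto simp: circuit_nth_support)
      have "0 = (g u * bracket \<alpha> c d f + g v * bracket \<alpha> f a b) * (bracket \<alpha> d e f * bracket \<alpha> e f b)"
        using ge by simp
      also have "\<dots> = (g u * bracket \<alpha> d e f) * bracket \<alpha> c d f * bracket \<alpha> e f b
          + (g v * bracket \<alpha> e f b) * bracket \<alpha> f a b * bracket \<alpha> d e f"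
        by (simp add: algebra_simps)
      also have "\<dots> = - g w * degeneracy \<alpha> a b c d e f"
        unfolding ga gc by (simp add: degeneracy_def algebra_simps)
      finally have "g w = 0" using nz by simp
      then show "g x = 0" using ga gc x bracket_nonzero by auto
    qed simp
    then have "dim {u, v, w} = 3"
      using ne by (simp add: dim_eq_card_independent)
    with cod show False by (simp add: codim_INT)
  qed
qed

section \<open>Recovering the pairing from a degenerate intersection\<close>

lemma not_subset_D_aux:
  assumes cod: "codim (\<Inter>L\<in>triple a b c d e f. D \<alpha> L) < 3"
    and dist': "distinct [p, q, r, s]" and out: "a \<notin> {p, q, r, s}" "c \<notin> {p, q, r, s}"
  shows "\<not> (\<Inter>L\<in>triple a b c d e f. D \<alpha> L) \<subseteq> D \<alpha> {p, q, r, s}"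
proof
  assume sub: "(\<Inter>L\<in>triple a b c d e f. D \<alpha> L) \<subseteq> D \<alpha> {p, q, r, s}"
  let ?z = "circuit \<alpha> p q r s"
  \<comment> \<open>\<open>u\<close> vanishes at \<open>a\<close> and \<open>v\<close> at \<open>c\<close>, so the two corrections to the unit vector at \<open>p\<close> do not
    interfere, and neither is seen by \<open>?z\<close>.\<close>
  define x where "x = axis p 1 - axis a (v $ p / v $ a) - axis c (u $ p / u $ c)"
  have inner_x: "z \<bullet> x = z $ p - z $ a * (v $ p / v $ a) - z $ c * (u $ p / u $ c)" for z
    by (simp add: x_def inner_diff_right inner_axis)
  have "u $ a = 0" "u $ c \<noteq> 0" "v $ a \<noteq> 0" "v $ c = 0"
    using gen dist by (auto simp: circuit_nth_support genericD)
  then have ux: "u \<bullet> x = 0" and vx: "v \<bullet> x = 0"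
    by (simp_all add: inner_x)
  \<comment> \<open>Degeneracy enters here: \<open>w\<close> depends on \<open>u\<close> and
    \<open>v\<close>, so a point built to satisfy two conditions satisfies the third as
    well.\<close>
  have "(bracket \<alpha> d e f * bracket \<alpha> e f b) * (w \<bullet> x) = 0"
    using arg_cong[OF circuit_dependence[OF cod[unfolded codim_less_3_iff]], of "\<lambda>y. y \<bullet> x"] ux vx
    by (simp add: inner_add_left)
  then have "w \<bullet> x = 0" using bracket_nonzero by simp
  with ux vx sub have "x \<in> D \<alpha> {p, q, r, s}" by (auto simp: INT_triple)
  then have "?z \<bullet> x = 0"
    using gen dist' by (simp add: D_eq_orthogonal_circuit genericD)
  moreover have "?z $ a = 0" "?z $ c = 0" "?z $ p \<noteq> 0"
    using circuit_nth_nonzero_iff[OF gen dist'] out by auto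
  ultimately show False by (simp add: inner_x)
qed

end

text \<open>Swapping the letters inside a pair preserves the triple, so \<open>i\<close> and
  \<open>j\<close> may be taken as the first letters of their pairs.\<close>

lemma not_subset_D:
  fixes \<alpha> :: "'n::finite \<Rightarrow> real^3"
  assumes "pairing \<alpha> a b c d e f" "codim (\<Inter>L\<in>triple a b c d e f. D \<alpha> L) < 3"
    and "card L = 4" "i \<in> {a, b}" "j \<in> {c, d}" "i \<notin> L" "j \<notin> L"
  shows "\<not> (\<Inter>L\<in>triple a b c d e f. D \<alpha> L) \<subseteq> D \<alpha> L"
proof -
  obtain i' j' where ij: "i' = (if i = a then b else a)" "j' = (if j = c then d else c)"
    by blast
  have eq: "triple i i' j j' e f = triple a b c d e f"
    using assms(4,5) ij by (auto simp: triple_def insert_commute)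
  have pairing: "pairing \<alpha> i i' j j' e f"
    using assms(1,4,5) ij by (auto simp: pairing_def)
  obtain xs where "set xs = L" "distinct xs"
    using finite_distinct_list[of L] by auto
  moreover from this assms(3) have "length xs = 4"
    using distinct_card by fastforce
  ultimately obtain p q r s where pqrs: "L = {p, q, r, s}" "distinct [p, q, r, s]"
    by (auto simp: eval_nat_numeral length_Suc_conv)
  show ?thesis
    using pairing.not_subset_D_aux[OF pairing, unfolded eq, OF assms(2) pqrs(2)] assms(6,7) pqrs(1) by simp
qed

text \<open>If the two indices missing from \<open>L\<close> came from different pairs,
  \<open>not_subset_D\<close> would refute the inclusion. So they form a pair, and \<open>L\<close>
  is its complement.\<close>

lemma triple_mem_iff_subset_D:
  fixes \<alpha> :: "'n::finite \<Rightarrow> real^3"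
  assumes pairing: "pairing \<alpha> a b c d e f" and cod: "codim (\<Inter>L\<in>triple a b c d e f. D \<alpha> L) < 3"
    and U: "UNIV = {a, b, c, d, e, f}" and L: "card L = 4"
  shows "L \<in> triple a b c d e f \<longleftrightarrow> (\<Inter>L\<in>triple a b c d e f. D \<alpha> L) \<subseteq> D \<alpha> L"
proof
  assume sub: "(\<Inter>L\<in>triple a b c d e f. D \<alpha> L) \<subseteq> D \<alpha> L"
  have dist: "distinct [a, b, c, d, e, f]"
    using pairing by (simp add: pairing_def)
  have "card (- L) = 2"
    using L dist by (simp add: Compl_eq_Diff_UNIV card_Diff_subset) (simp add: U)
  then obtain i j where ij: "- L = {i, j}" "i \<noteq> j"
    by (auto simp: card_2_iff)
  \<comment> \<open>Rotating the three pairs cyclically covers all choices of two different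
    pairs.\<close>
  have perm: "triple c d e f a b = triple a b c d e f" "triple e f a b c d = triple a b c d e f"
    by (auto simp: triple_def insert_commute)
  have pairing': "pairing \<alpha> c d e f a b" "pairing \<alpha> e f a b c d"
    using pairing by (auto simp: pairing_def)
  note not_sub = not_subset_D[OF pairing cod L] not_subset_D[OF pairing'(1), unfolded perm, OF cod L]
    not_subset_D[OF pairing'(2), unfolded perm, OF cod L]
  have "\<not> (x \<in> {a, b} \<and> y \<in> {c, d})" "\<not> (x \<in> {c, d} \<and> y \<in> {e, f})"
    "\<not> (x \<in> {e, f} \<and> y \<in> {a, b})" if "x \<notin> L" "y \<notin> L" for x y
    using that sub not_sub by metis+
  note this[of i j] this[of j i]
  moreover have "i \<notin> L" "j \<notin> L"
    using ij by blast+
  moreover have "x \<in> {a, b} \<or> x \<in> {c, d} \<or> x \<in> {e, f}" for x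
    using UNIV_I[of x] unfolding U by simp
  note this[of i] this[of j]
  moreover have "{i, j} = {x, y}" if "i \<in> {x, y}" "j \<in> {x, y}" for x y
    using that ij(2) by auto
  ultimately have "{i, j} = {a, b} \<or> {i, j} = {c, d} \<or> {i, j} = {e, f}"
    by metis
  moreover have "L = - {i, j}"
    unfolding ij(1)[symmetric] by simp
  ultimately show "L \<in> triple a b c d e f"
    unfolding triple_eq_Compl[OF dist U] by blast
qed blast

text \<open>A degenerate intersection recovers its triple as the set of all 4-element
  \<open>L\<close> whose hyperplane contains it. The codimension bound passes to the second triple
  through \<open>eq\<close>.\<close>

lemma triple_eq_if_INT_eq:
  fixes \<alpha> :: "'n::finite \<Rightarrow> real^3"
  assumes "pairing \<alpha> a b c d e f" "codim (\<Inter>L\<in>triple a b c d e f. D \<alpha> L) < 3"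
      "UNIV = {a, b, c, d, e, f}"
    and "pairing \<alpha> a' b' c' d' e' f'" "UNIV = {a', b', c', d', e', f'}"
    and eq: "(\<Inter>L\<in>triple a b c d e f. D \<alpha> L) = (\<Inter>L\<in>triple a' b' c' d' e' f'. D \<alpha> L)"
  shows "triple a b c d e f = triple a' b' c' d' e' f'"
proof -
  have card: "L \<in> triple a b c d e f \<Longrightarrow> card L = 4" "L \<in> triple a' b' c' d' e' f' \<Longrightarrow> card L = 4" for L
    using assms(1,4) by (auto simp: pairing_def triple_def)
  have "L \<in> triple a b c d e f \<longleftrightarrow> L \<in> triple a' b' c' d' e' f'" if "card L = 4" for L
    using triple_mem_iff_subset_D[OF assms(1-3) that]
      triple_mem_iff_subset_D[OF assms(4) _ assms(5) that] assms(2) eq by simp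
  with card show ?thesis by blast
qed

section \<open>Pairings of six indices\<close>

lemma exhaust_6: "i \<in> {1, 2, 3, 4, 5, 6}" for i :: 6
proof (induct i)
  case (of_int z)
  \<comment> \<open>Representatives run from 0 to 5, and 0 is the numeral 6.\<close>
  then have "z = 0 \<or> z = 1 \<or> z = 2 \<or> z = 3 \<or> z = 4 \<or> z = 5" by (simp; presburger)
  then show ?case by auto
qed

lemma UNIV_6: "(UNIV :: 6 set) = {1, 2, 3, 4, 5, 6}"
  using exhaust_6 by blast

text \<open>The 15 perfect matchings of six points, each listed once: 1 comes first, the third entry
  is the least index left, and the last two entries increase.\<close>

definition pairings :: "(6 \<times> 6 \<times> 6 \<times> 6 \<times> 6 \<times> 6) set" where
  "pairings = {(1,2,3,4,5,6), (1,2,3,5,4,6), (1,2,3,6,4,5), (1,3,2,4,5,6), (1,3,2,5,4,6),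
    (1,3,2,6,4,5), (1,4,2,3,5,6), (1,4,2,5,3,6), (1,4,2,6,3,5), (1,5,2,3,4,6), (1,5,2,4,3,6),
    (1,5,2,6,3,4), (1,6,2,3,4,5), (1,6,2,4,3,5), (1,6,2,5,3,4)}"

text \<open>These swaps generate the symmetry group of a pairing, of order 48.\<close>

lemma triple_swaps:
  "triple b a c d e f = triple a b c d e f"
  "triple c d a b e f = triple a b c d e f"
  "triple e f c d a b = triple a b c d e f"
  "triple a b d c e f = triple a b c d e f"
  "triple a b c d f e = triple a b c d e f"
  "triple a b e f c d = triple a b c d e f"
  by (auto simp: triple_def insert_commute)

text \<open>First normalisation step; the covering equation is carried along so that distinctness
  can be read off again after reordering.\<close>

lemma triple_wlog_first:
  assumes T: "T = triple a b c d e f" and U: "{a, b, c, d, e, f} = U" and x: "x \<in> {a, b, c, d, e, f}"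
  shows "\<exists>b c d e f. T = triple x b c d e f \<and> {x, b, c, d, e, f} = U"
proof -
  have "T = triple b a c d e f" "T = triple c d a b e f" "T = triple d c a b e f"
    "T = triple e f c d a b" "T = triple f e c d a b"
    by (simp_all add: T triple_swaps)
  moreover have "{b, a, c, d, e, f} = U" "{c, d, a, b, e, f} = U" "{d, c, a, b, e, f} = U"
    "{e, f, c, d, a, b} = U" "{f, e, c, d, a, b} = U"
    unfolding U[symmetric] by auto
  ultimately show ?thesis using T U x by blast
qed

lemma triple_wlog_third:
  assumes T: "T = triple a b c d e f" and U: "{a, b, c, d, e, f} = U" and x: "x \<in> {c, d, e, f}"
  shows "\<exists>d e f. T = triple a b x d e f \<and> {a, b, x, d, e, f} = U"
proof -
  have "T = triple a b d c e f" "T = triple a b e f c d" "T = triple a b f e c d"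
    by (simp_all add: T triple_swaps)
  moreover have "{a, b, d, c, e, f} = U" "{a, b, e, f, c, d} = U" "{a, b, f, e, c, d} = U"
    unfolding U[symmetric] by auto
  ultimately show ?thesis using T U x by blast
qed

lemma UNIV_6_distinct:
  assumes "{a, b, c, d, e, f} = (UNIV :: 6 set)"
  shows "distinct [a, b, c, d, e, f]"
  by (rule card_distinct) (use assms in simp)

lemma pairings_distinct:
  assumes "(a, b, c, d, e, f) \<in> pairings"
  shows "distinct [a, b, c, d, e, f]"
proof -
  have "\<forall>(a, b, c, d, e, f)\<in>pairings. distinct [a, b, c, d, e, f]"
    unfolding pairings_def ball_simps prod.case by simp
  with assms show ?thesis by blast
qed

lemma pairings_UNIV:
  assumes "(a, b, c, d, e, f) \<in> pairings"
  shows "UNIV = {a, b, c, d, e, f}"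
proof -
  have "card (set [a, b, c, d, e, f]) = CARD(6)"
    using distinct_card[OF pairings_distinct[OF assms]] by simp
  from card_eq_UNIV_imp_eq_UNIV[OF _ this] show ?thesis by simp
qed

text \<open>The conditional is the least index other than 1 and \<open>b\<close>; once it stands
  third, only the order of the last two entries is free.\<close>

lemma pairings_cases:
  assumes "distinct [1, b, if b = 2 then 3 else 2, d, e, f]"
  shows "(1, b, if b = 2 then 3 else 2, d, e, f) \<in> pairings \<or>
    (1, b, if b = 2 then 3 else 2, d, f, e) \<in> pairings"
proof -
  have "b = 2 \<or> b = 3 \<or> b = 4 \<or> b = 5 \<or> b = 6"
    using exhaust_6[of b] assms by simp
  then show ?thesis
    using assms exhaust_6[of d] exhaust_6[of e] exhaust_6[of f]
    by (elim disjE) (simp; elim disjE; simp add: pairings_def)+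
qed

text \<open>Normal form: move 1 to the front, then the least index outside the first pair to third
  place, then order the last pair.\<close>

lemma good_triples_eq: "good_triples = (\<lambda>(a, b, c, d, e, f). triple a b c d e f) ` pairings"
proof
  show "good_triples \<subseteq> (\<lambda>(a, b, c, d, e, f). triple a b c d e f) ` pairings"
  proof
    fix T assume "T \<in> good_triples"
    then obtain a b c d e f where "T = triple a b c d e f" "{a, b, c, d, e, f} = (UNIV :: 6 set)"
      unfolding good_triples_def triple_def[symmetric] by blast
    then have "\<exists>b c d e f. T = triple 1 b c d e f \<and> {1, b, c, d, e, f} = (UNIV :: 6 set)"
      by (intro triple_wlog_first) auto
    then obtain b c d e f where T: "T = triple 1 b c d e f" and U: "{1, b, c, d, e, f} = (UNIV :: 6 set)"
      by blast
    define x :: 6 where "x = (if b = 2 then 3 else 2)"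
    have "x \<in> {1, b, c, d, e, f}" "x \<noteq> 1" "x \<noteq> b"
      by (simp_all add: U x_def)
    then have "\<exists>d e f. T = triple 1 b x d e f \<and> {1, b, x, d, e, f} = (UNIV :: 6 set)"
      by (intro triple_wlog_third[OF T U]) auto
    then obtain d e f where T: "T = triple 1 b x d e f" and U: "{1, b, x, d, e, f} = (UNIV :: 6 set)"
      by blast
    have "(1, b, x, d, e, f) \<in> pairings \<or> (1, b, x, d, f, e) \<in> pairings"
      using UNIV_6_distinct[OF U] unfolding x_def by (rule pairings_cases)
    then show "T \<in> (\<lambda>(a, b, c, d, e, f). triple a b c d e f) ` pairings"
      using T triple_swaps(5)[of 1 b x d e f] by (auto intro: rev_image_eqI)
  qed
next
  show "(\<lambda>(a, b, c, d, e, f). triple a b c d e f) ` pairings \<subseteq> good_triples"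
  proof (rule image_subsetI, clarify)
    fix a b c d e f assume "(a, b, c, d, e, f) \<in> pairings"
    from pairings_UNIV[OF this, symmetric] show "triple a b c d e f \<in> good_triples"
      unfolding good_triples_def triple_def by blast
  qed
qed

section \<open>The dodecahedral arrangement\<close>

text \<open>Rewrite rules that bring any polynomial in \<open>golden\<close> to degree at most one;
  the second one reaches into right-nested products.\<close>

lemma golden_square: "golden * golden = golden + 1" "golden * (golden * x) = golden * x + x"
proof -
  show *: "golden * golden = golden + 1"
    by (simp add: golden_def field_simps)
  show "golden * (golden * x) = golden * x + x"
    unfolding mult.assoc[symmetric] * by (simp add: algebra_simps)
qed

lemma golden_pos: "golden > 0"
  by (simp add: golden_def add_pos_pos)

lemma dodecahedral_nth:
  "dodecahedral 1 $ 1 = 1" "dodecahedral 1 $ 2 = 0" "dodecahedral 1 $ 3 = golden"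
  "dodecahedral 2 $ 1 = 1" "dodecahedral 2 $ 2 = 0" "dodecahedral 2 $ 3 = - golden"
  "dodecahedral 3 $ 1 = 0" "dodecahedral 3 $ 2 = golden" "dodecahedral 3 $ 3 = 1"
  "dodecahedral 4 $ 1 = 0" "dodecahedral 4 $ 2 = - golden" "dodecahedral 4 $ 3 = 1"
  "dodecahedral 5 $ 1 = golden" "dodecahedral 5 $ 2 = 1" "dodecahedral 5 $ 3 = 0"
  "dodecahedral 6 $ 1 = - golden" "dodecahedral 6 $ 2 = 1" "dodecahedral 6 $ 3 = 0"
  by (simp_all add: dodecahedral_def vector_3)

text \<open>The six lines are equiangular, and every bracket of distinct normals is, up to sign,
  \<open>2 * golden\<close> or \<open>2 * golden + 2\<close>.\<close>

lemma generic_dodecahedral: "generic dodecahedral"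
proof -
  have "\<forall>i\<in>{1, 2, 3, 4, 5, 6}. \<forall>j\<in>{1, 2, 3, 4, 5, 6}. \<forall>k\<in>{1, 2, 3, 4, 5, 6}.
      i \<noteq> j \<longrightarrow> i \<noteq> k \<longrightarrow> j \<noteq> k \<longrightarrow> bracket dodecahedral i j k \<noteq> 0"
    using golden_pos by (simp add: dodecahedral_nth bracket_expand algebra_simps golden_square)
  then show ?thesis
    unfolding generic_def UNIV_6[symmetric] by simp
qed

text \<open>The five members of \<open>pairings\<close> left out form a 1-factorisation of the
  complete graph on six points: each 2-element set is a pair in exactly one of them.\<close>

definition degenerate_pairings :: "(6 \<times> 6 \<times> 6 \<times> 6 \<times> 6 \<times> 6) set" where
  "degenerate_pairings = {(1,2,3,5,4,6), (1,2,3,6,4,5), (1,3,2,4,5,6), (1,3,2,6,4,5), (1,4,2,3,5,6),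
    (1,4,2,5,3,6), (1,5,2,3,4,6), (1,5,2,6,3,4), (1,6,2,4,3,5), (1,6,2,5,3,4)}"

lemma degenerate_pairings_subset: "degenerate_pairings \<subseteq> pairings"
  by (simp add: degenerate_pairings_def pairings_def)

text \<open>Direct evaluation at the 15 representatives: reduction by \<open>golden_square\<close>
  either cancels completely or leaves a value that \<open>golden_pos\<close> separates from
  zero.\<close>

lemma degeneracy_dodecahedral:
  assumes "(a, b, c, d, e, f) \<in> pairings"
  shows "degeneracy dodecahedral a b c d e f = 0 \<longleftrightarrow> (a, b, c, d, e, f) \<in> degenerate_pairings"
proof -
  have "\<forall>(a, b, c, d, e, f)\<in>pairings. degeneracy dodecahedral a b c d e f = 0 \<longleftrightarrow>
      (a, b, c, d, e, f) \<in> degenerate_pairings"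
    using golden_pos
    unfolding pairings_def ball_simps prod.case
    by (simp add: degenerate_pairings_def degeneracy_def dodecahedral_nth bracket_expand
        algebra_simps golden_square)
  with assms show ?thesis by blast
qed

section \<open>Counting the degenerate intersections\<close>

lemma inj_uminus_set: "inj (uminus :: 'a set \<Rightarrow> 'a set)"
  by (rule injI) simp

text \<open>Complementation is injective, so it suffices to tell apart ten explicit sets of
  pairs.\<close>

lemma card_degenerate_triples:
  "card ((\<lambda>(a, b, c, d, e, f). triple a b c d e f) ` degenerate_pairings) = 10"
proof -
  have "triple a b c d e f = uminus ` {{a, b}, {c, d}, {e, f}}"
    if "(a, b, c, d, e, f) \<in> degenerate_pairings" for a b c d e f
    using that degenerate_pairings_subset
    by (intro triple_eq_Compl pairings_distinct pairings_UNIV) blast+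
  then have "(\<lambda>(a, b, c, d, e, f). triple a b c d e f) ` degenerate_pairings =
      image uminus ` (\<lambda>(a, b, c, d, e, f). {{a, b}, {c, d}, {e, f}}) ` degenerate_pairings"
    by (force simp: image_image intro!: image_cong)
  also have "card \<dots> = card ((\<lambda>(a, b, c, d, e, f). {{a, b}, {c, d}, {e, f}}) ` degenerate_pairings)"
    by (intro card_image inj_onI) (simp add: inj_image_eq_iff[OF inj_uminus_set])
  also have "\<dots> = 10"
    by (simp add: degenerate_pairings_def card_insert_if set_eq_subset)
  finally show ?thesis .
qed

theorem proposition18:
  shows "card (non_very_generic_intersections dodecahedral) = 10"
proof -
  let ?t = "\<lambda>(a, b, c, d, e, f). triple a b c d e f :: 6 set set"
  let ?X = "\<lambda>T. \<Inter>L\<in>T. D dodecahedral L"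
  have pairing: "pairing dodecahedral a b c d e f" if "(a, b, c, d, e, f) \<in> pairings" for a b c d e f
    using pairings_distinct[OF that] generic_dodecahedral by (simp add: pairing_def)
  note sub = degenerate_pairings_subset
  have cod: "codim (?X (triple a b c d e f)) < 3 \<longleftrightarrow> (a, b, c, d, e, f) \<in> degenerate_pairings"
    if "(a, b, c, d, e, f) \<in> pairings" for a b c d e f
    using pairing.codim_less_3_iff[OF pairing[OF that]] degeneracy_dodecahedral[OF that] by simp
  have "non_very_generic_intersections dodecahedral = ?X ` ?t ` degenerate_pairings"
  proof -
    have "{T \<in> good_triples. codim (?X T) < 3} = ?t ` degenerate_pairings"
    proof (intro equalityI subsetI)
      fix T assume "T \<in> {T \<in> good_triples. codim (?X T) < 3}"
      then obtain a b c d e f where "(a, b, c, d, e, f) \<in> pairings" "T = triple a b c d e f"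
        "codim (?X (triple a b c d e f)) < 3"
        unfolding good_triples_eq by (clarsimp simp del: INT_iff)
      then show "T \<in> ?t ` degenerate_pairings"
        using cod by (intro image_eqI[of _ _ "(a, b, c, d, e, f)"]) simp_all
    next
      fix T assume "T \<in> ?t ` degenerate_pairings"
      then obtain a b c d e f where d: "(a, b, c, d, e, f) \<in> degenerate_pairings" "T = triple a b c d e f"
        by clarsimp
      then have p: "(a, b, c, d, e, f) \<in> pairings"
        using sub by blast
      then have "T \<in> good_triples"
        unfolding good_triples_eq d(2) by (intro image_eqI[of _ _ "(a, b, c, d, e, f)"]) simp_all
      with d cod[OF p] show "T \<in> {T \<in> good_triples. codim (?X T) < 3}"
        by simp
    qed
    moreover have "non_very_generic_intersections dodecahedral = ?X ` {T \<in> good_triples. codim (?X T) < 3}"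
      unfolding non_very_generic_intersections_def by (rule setcompr_eq_image)
    ultimately show ?thesis by (simp only:)
  qed
  \<comment> \<open>Subspaces are counted, not triples, so different degenerate triples must give
    different intersections.\<close>
  moreover have "inj_on ?X (?t ` degenerate_pairings)"
  proof (rule inj_onI)
    fix S T assume S: "S \<in> ?t ` degenerate_pairings" and T: "T \<in> ?t ` degenerate_pairings"
      and eq: "?X S = ?X T"
    obtain a b c d e f where S_eq: "S = triple a b c d e f" and abc: "(a, b, c, d, e, f) \<in> degenerate_pairings"
      using S by auto
    obtain a' b' c' d' e' f' where T_eq: "T = triple a' b' c' d' e' f'"
      and abc': "(a', b', c', d', e', f') \<in> degenerate_pairings"
      using T by auto
    note p = subsetD[OF sub abc] and p' = subsetD[OF sub abc']
    show "S = T"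
      using triple_eq_if_INT_eq[OF pairing[OF p] cod[OF p, THEN iffD2, OF abc] pairings_UNIV[OF p]
        pairing[OF p'] pairings_UNIV[OF p'] eq[unfolded S_eq T_eq]]
      by (simp only: S_eq T_eq)
  qed
  ultimately show ?thesis
    by (simp add: card_image card_degenerate_triples)
qed

end
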